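(* For every domain size $k$, every $\alpha\in(0,1]$, and every $\varepsilon_1,\varepsilon_2\in(0,1]$, there exists a private-coin protocol for closeness testing between two unknown distributions $\mathbf p,\mathbf q$ over $[k]$ with distance parameter $\alpha$, using $n_1=O\!\left(\frac{k^{3/2}}{\alpha^2\varepsilon_1^2}\right)$ users holding samples from $\mathbf p$ and $n_2=O\!\left(\frac{k^{3/2}}{\alpha^2\varepsilon_2^2}\right)$ users holding samples from $\mathbf q$, which is $(\varepsilon_1,0)$-locally differentially private for the users holding samples from $\mathbf p$ and $(\varepsilon_2,0)$-locally differentially private for the users holding samples from $\mathbf q$.
   Context: Closeness testing: given $\alpha\in(0,1]$ and independent samples from unknown distributions $\mathbf p,\mathbf q$ over $[k]=\{1,\dots,k\}$, output accept with probability at least $2/3$ if $\mathbf p=\mathbf q$, and reject with probability at least $2/3$ if $d_{TV}(\mathbf p,\mathbf q)=\frac12\|\mathbf p-\mathbf q\|_1>\alpha$. Heterogeneous local model: there are $n_1$ users, each holding one independent sample $x_i\sim\mathbf p$, and $n_2$ users, each holding one independent sample $x'_i\sim\mathbf q$. Each user of the first group applies a randomizer $R_i(x_i,U)$ and each user of the second group a randomizer $R'_i(x'_i,U)$, where $U$ is a public random string of length $r$ independent of the data; an analyzer receives all $n_1+n_2$ messages (knowing which group each came from) and $U$, and outputs accept or reject satisfying the closeness testing guarantee. The protocol is private-coin if $r=0$ (no shared randomness; each user uses only independent private randomness) and public-coin otherwise. A randomizer $R$ is $(\varepsilon,\delta)$-locally differentially private if for every value of $U$, all inputs $x,x'$ and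 all measurable sets $S$ of outputs, $\Pr[R(x,U)\in S]\le e^{\varepsilon}\Pr[R(x',U)\in S]+\delta$. The protocol is $(\varepsilon_1,0)$-LDP for the first group if every $R_i$ is $(\varepsilon_1,0)$-LDP, and $(\varepsilon_2,0)$-LDP for the second group if every $R'_i$ is $(\varepsilon_2,0)$-LDP. *)

theory Defs
  imports "HOL-Probability.Probability"
begin

abbreviation domain_space :: "nat \<Rightarrow> nat measure" where
  "domain_space k \<equiv> count_space {1..k}"

definition distribution_over :: "nat \<Rightarrow> nat measure \<Rightarrow> bool" where
  "distribution_over k p \<longleftrightarrow> p \<in> space (prob_algebra (domain_space k))"

definition tv_dist :: "nat \<Rightarrow> nat measure \<Rightarrow> nat measure \<Rightarrow> real" where
  "tv_dist k p q = 1 / 2 * (\<Sum>x\<in>{1..k}. \<bar>measure p {x} - measure q {x}\<bar>)"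

text \<open>
  A non-interactive protocol with two groups of users. Group 1 holds samples from \<open>p\<close>, group 2
  holds samples from \<open>q\<close>; users are numbered from 0 in each group. The output of a randomizer
  is given by its law: \<open>rand1 P i u x\<close> is the distribution, over the message space \<open>msg1 P i\<close>, of
  the message of user \<open>i\<close> on input \<open>x\<close> and public string \<open>u\<close>. This kernel accounts for the private
  randomness of the user. The analyzer may be randomized as well; output \<open>True\<close> means accept.
\<close>

record 'm protocol =
  pub_len  :: nat
  users1   :: nat
  users2   :: nat
  msg1     :: "nat \<Rightarrow> 'm measure"
  msg2     :: "nat \<Rightarrow> 'm measure"
  rand1    :: "nat \<Rightarrow> bool list \<Rightarrow> nat \<Rightarrow> 'm measure"
  rand2    :: "nat \<Rightarrow> bool list \<Rightarrow> nat \<Rightarrow> 'm measure"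
  analyzer :: "bool list \<times> (nat \<Rightarrow> 'm) \<times> (nat \<Rightarrow> 'm) \<Rightarrow> bool measure"

definition pub_strings :: "'m protocol \<Rightarrow> bool list set" where
  "pub_strings P = {u. length u = pub_len P}"

definition valid_protocol :: "nat \<Rightarrow> 'm protocol \<Rightarrow> bool" where
  "valid_protocol k P \<longleftrightarrow>
     (\<forall>i<users1 P. \<forall>u\<in>pub_strings P. rand1 P i u \<in> domain_space k \<rightarrow>\<^sub>M prob_algebra (msg1 P i)) \<and>
     (\<forall>i<users2 P. \<forall>u\<in>pub_strings P. rand2 P i u \<in> domain_space k \<rightarrow>\<^sub>M prob_algebra (msg2 P i)) \<and>
     analyzer P \<in> count_space (pub_strings P) \<Otimes>\<^sub>M
                    ((\<Pi>\<^sub>M i\<in>{..<users1 P}. msg1 P i) \<Otimes>\<^sub>M (\<Pi>\<^sub>M i\<in>{..<users2 P}. msg2 P i))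
                  \<rightarrow>\<^sub>M prob_algebra (count_space UNIV)"

definition private_coin :: "'m protocol \<Rightarrow> bool" where
  "private_coin P \<longleftrightarrow> pub_len P = 0"

text \<open>
  Given the public string, the messages of distinct users are independent, and the message of a
  user is obtained by drawing a fresh sample and applying the randomizer of that user to it.
\<close>

definition messages_law ::
    "'m protocol \<Rightarrow> nat measure \<Rightarrow> nat measure \<Rightarrow> bool list \<Rightarrow> ((nat \<Rightarrow> 'm) \<times> (nat \<Rightarrow> 'm)) measure" where
  "messages_law P p q u =
     (\<Pi>\<^sub>M i\<in>{..<users1 P}. p \<bind> rand1 P i u) \<Otimes>\<^sub>M (\<Pi>\<^sub>M i\<in>{..<users2 P}. q \<bind> rand2 P i u)"

definition output_law :: "'m protocol \<Rightarrow> nat measure \<Rightarrow> nat measure \<Rightarrow> bool measure" where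
  "output_law P p q =
     uniform_count_measure (pub_strings P) \<bind>
       (\<lambda>u. messages_law P p q u \<bind> (\<lambda>m. analyzer P (u, m)))"

definition closeness_tester :: "nat \<Rightarrow> real \<Rightarrow> 'm protocol \<Rightarrow> bool" where
  "closeness_tester k \<alpha> P \<longleftrightarrow>
     (\<forall>p q. distribution_over k p \<longrightarrow> distribution_over k q \<longrightarrow>
        (p = q \<longrightarrow> measure (output_law P p q) {True} \<ge> 2 / 3) \<and>
        (tv_dist k p q > \<alpha> \<longrightarrow> measure (output_law P p q) {False} \<ge> 2 / 3))"

text \<open>
  A randomizer with message space \<open>M\<close>, inputs in \<open>{1..k}\<close> and public strings in \<open>Us\<close>.
\<close>

definition ldp_randomizer ::
    "nat \<Rightarrow> bool list set \<Rightarrow> 'm measure \<Rightarrow> real \<Rightarrow> real \<Rightarrow> (bool list \<Rightarrow> nat \<Rightarrow> 'm measure) \<Rightarrow> bool" where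
  "ldp_randomizer k Us M \<epsilon> \<delta> R \<longleftrightarrow>
     (\<forall>u\<in>Us. \<forall>x\<in>{1..k}. \<forall>x'\<in>{1..k}. \<forall>S\<in>sets M.
        measure (R u x) S \<le> exp \<epsilon> * measure (R u x') S + \<delta>)"

definition ldp_group1 :: "nat \<Rightarrow> real \<Rightarrow> real \<Rightarrow> 'm protocol \<Rightarrow> bool" where
  "ldp_group1 k \<epsilon> \<delta> P \<longleftrightarrow>
     (\<forall>i<users1 P. ldp_randomizer k (pub_strings P) (msg1 P i) \<epsilon> \<delta> (rand1 P i))"

definition ldp_group2 :: "nat \<Rightarrow> real \<Rightarrow> real \<Rightarrow> 'm protocol \<Rightarrow> bool" where
  "ldp_group2 k \<epsilon> \<delta> P \<longleftrightarrow>
     (\<forall>i<users2 P. ldp_randomizer k (pub_strings P) (msg2 P i) \<epsilon> \<delta> (rand2 P i))"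

end

theory Submission
  imports Defs
begin

text \<open>
  User \<open>i\<close> holding \<open>x\<close> sends a random sign with mean \<open>\<epsilon>/6 \<cdot> hartley k i x\<close>, where \<open>hartley k\<close> is a
  real orthogonal system of period \<open>k\<close> in \<open>i\<close>. The signs of the users with a common \<open>i mod k\<close> thus
  estimate one coordinate of the Hartley transform of the unknown distribution, and by Parseval and
  Cauchy--Schwarz the transforms of \<open>p\<close> and \<open>q\<close> have squared distance
  \<open>k \<cdot> \<parallel>p - q\<parallel>\<^sub>2\<^sup>2 \<ge> 4 d\<^sub>T\<^sub>V(p, q)\<^sup>2\<close>. With \<open>m \<sim> \<surd>k / (\<alpha>\<^sup>2 \<epsilon>\<^sup>2)\<close> users per block each coordinate
  difference is estimated with variance \<open>O(\<alpha>\<^sup>2 / \<surd>k)\<close>, and Chebyshev's inequality separates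
  squared distance \<open>0\<close> from squared distance at least \<open>4 \<alpha>\<^sup>2\<close>.
\<close>

section \<open>Moments of sums and products of independent variables\<close>

context prob_space
begin

text \<open>Squares of independent variables are independent, so the second moment of the product
  factors and no fourth moments are needed. Writing each second moment as variance plus squared
  mean, the product of the squared means cancels against the squared mean of the product.\<close>

lemma
  fixes X Y :: "'a \<Rightarrow> real"
  assumes ind: "indep_var borel X borel Y"
    and X2: "integrable M (\<lambda>\<omega>. (X \<omega>)\<^sup>2)" and Y2: "integrable M (\<lambda>\<omega>. (Y \<omega>)\<^sup>2)"
  shows integrable_indep_add_sq: "integrable M (\<lambda>\<omega>. (X \<omega> + Y \<omega>)\<^sup>2)"
    and variance_indep_add: "variance (\<lambda>\<omega>. X \<omega> + Y \<omega>) = variance X + variance Y"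
    and integrable_indep_mult_sq: "integrable M (\<lambda>\<omega>. (X \<omega> * Y \<omega>)\<^sup>2)"
    and variance_indep_mult: "variance (\<lambda>\<omega>. X \<omega> * Y \<omega>) =
      variance X * variance Y + (expectation X)\<^sup>2 * variance Y + (expectation Y)\<^sup>2 * variance X"
proof -
  have [measurable]: "random_variable borel X" "random_variable borel Y"
    using ind by (auto dest: indep_var_rv1 indep_var_rv2)
  have [simp]: "integrable M X" "integrable M Y"
    using X2 Y2 by (auto intro: square_integrable_imp_integrable)
  have XY [simp]: "integrable M (\<lambda>\<omega>. X \<omega> * Y \<omega>)"
    by (rule indep_var_integrable[OF ind]) auto
  have EXY: "expectation (\<lambda>\<omega>. X \<omega> * Y \<omega>) = expectation X * expectation Y"
    by (rule indep_var_lebesgue_integral[OF ind]) auto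
  have sq: "(\<lambda>\<omega>. (X \<omega> + Y \<omega>)\<^sup>2) = (\<lambda>\<omega>. (X \<omega>)\<^sup>2 + (Y \<omega>)\<^sup>2 + 2 * (X \<omega> * Y \<omega>))"
    by (simp add: power2_sum mult.assoc)
  show S: "integrable M (\<lambda>\<omega>. (X \<omega> + Y \<omega>)\<^sup>2)"
    unfolding sq using X2 Y2 by simp
  have "variance (\<lambda>\<omega>. X \<omega> + Y \<omega>) =
      expectation (\<lambda>\<omega>. (X \<omega> + Y \<omega>)\<^sup>2) - (expectation X + expectation Y)\<^sup>2"
    using S by (subst variance_eq) simp_all
  also have "\<dots> = variance X + variance Y"
    unfolding sq using X2 Y2 by (simp add: variance_eq EXY power2_sum)
  finally show "variance (\<lambda>\<omega>. X \<omega> + Y \<omega>) = variance X + variance Y" .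
  have ind2: "indep_var borel (\<lambda>\<omega>. (X \<omega>)\<^sup>2) borel (\<lambda>\<omega>. (Y \<omega>)\<^sup>2)"
    using indep_var_compose[OF ind, of "\<lambda>x. x\<^sup>2" borel "\<lambda>x. x\<^sup>2" borel] by (simp add: comp_def)
  show P: "integrable M (\<lambda>\<omega>. (X \<omega> * Y \<omega>)\<^sup>2)"
    using indep_var_integrable[OF ind2 X2 Y2] by (simp add: power_mult_distrib)
  have "expectation (\<lambda>\<omega>. (X \<omega> * Y \<omega>)\<^sup>2) = expectation (\<lambda>\<omega>. (X \<omega>)\<^sup>2) * expectation (\<lambda>\<omega>. (Y \<omega>)\<^sup>2)"
    using indep_var_lebesgue_integral[OF ind2 X2 Y2] by (simp add: power_mult_distrib)
  then have EXY2: "expectation (\<lambda>\<omega>. (X \<omega> * Y \<omega>)\<^sup>2) =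
      (variance X + (expectation X)\<^sup>2) * (variance Y + (expectation Y)\<^sup>2)"
    using X2 Y2 by (simp add: variance_eq)
  have "variance (\<lambda>\<omega>. X \<omega> * Y \<omega>) =
      (variance X + (expectation X)\<^sup>2) * (variance Y + (expectation Y)\<^sup>2)
      - (expectation X * expectation Y)\<^sup>2"
    using P by (subst variance_eq) (simp_all only: XY EXY EXY2)
  then show "variance (\<lambda>\<omega>. X \<omega> * Y \<omega>) =
      variance X * variance Y + (expectation X)\<^sup>2 * variance Y + (expectation Y)\<^sup>2 * variance X"
    by (simp only: power_mult_distrib distrib_left distrib_right) (simp only: algebra_simps)
qed

lemma
  fixes X :: "'i \<Rightarrow> 'a \<Rightarrow> real"
  assumes "finite I" and "indep_vars (\<lambda>_. borel) X I"
    and "\<And>i. i \<in> I \<Longrightarrow> integrable M (\<lambda>\<omega>. (X i \<omega>)\<^sup>2)"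
  shows integrable_indep_sum_sq: "integrable M (\<lambda>\<omega>. (\<Sum>i\<in>I. X i \<omega>)\<^sup>2)" (is ?int)
    and variance_indep_sum: "variance (\<lambda>\<omega>. \<Sum>i\<in>I. X i \<omega>) = (\<Sum>i\<in>I. variance (X i))" (is ?var)
proof -
  \<comment> \<open>Both claims share one induction: adding a variance requires the shorter sum to
    be known square integrable.\<close>
  have "?int \<and> ?var"
    using assms
  proof (induction I rule: finite_induct)
    case (insert i I)
    have IH: "integrable M (\<lambda>\<omega>. (\<Sum>i\<in>I. X i \<omega>)\<^sup>2)"
      "variance (\<lambda>\<omega>. \<Sum>i\<in>I. X i \<omega>) = (\<Sum>i\<in>I. variance (X i))"
      using insert.IH insert.prems indep_vars_subset[of _ X "insert i I" I] by auto
    have ind: "indep_var borel (X i) borel (\<lambda>\<omega>. \<Sum>i\<in>I. X i \<omega>)"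
      using insert by (intro indep_vars_sum) auto
    have sq: "integrable M (\<lambda>\<omega>. (X i \<omega>)\<^sup>2)"
      using insert.prems by simp
    show ?case
      using integrable_indep_add_sq[OF ind sq IH(1)] variance_indep_add[OF ind sq IH(1)] IH(2)
        insert.hyps by simp
  qed simp
  then show ?int ?var by auto
qed

lemma indep_vars_block_sum:
  fixes X :: "'i \<Rightarrow> 'a \<Rightarrow> real"
  assumes ind: "indep_vars (\<lambda>_. borel) X I"
    and K: "\<And>j. j \<in> L \<Longrightarrow> K j \<subseteq> I" "disjoint_family_on K L"
  shows "indep_vars (\<lambda>_. borel) (\<lambda>j \<omega>. \<Sum>i\<in>K j. X i \<omega>) L"
proof -
  \<comment> \<open>Each block sum is written as a measurable function of the restriction of the
    family to its block; restrictions to disjoint blocks are independent.\<close>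
  have "indep_vars (\<lambda>_. borel)
      (\<lambda>j \<omega>. (\<lambda>x. \<Sum>i\<in>K j. x i) (restrict (\<lambda>i. X i \<omega>) (K j))) L"
    by (intro indep_vars_compose2[OF indep_vars_restrict[OF ind K]] borel_measurable_sum
        measurable_component_singleton) auto
  then show ?thesis by simp
qed

text \<open>
  Splitting the users into two halves gives, for every coordinate \<open>j\<close>, two independent estimates
  of the same mean; the sum of their products estimates the squared norm of the mean vector
  without bias, so no diagonal term has to be subtracted.
\<close>

lemma
  fixes D :: "nat \<Rightarrow> 'a \<Rightarrow> real"
  assumes ind: "indep_vars (\<lambda>_. borel) D {..<2 * k}"
    and sq: "\<And>j. j < 2 * k \<Longrightarrow> integrable M (\<lambda>\<omega>. (D j \<omega>)\<^sup>2)"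
    and E: "\<And>j. j < k \<Longrightarrow> expectation (D j) = \<mu> j" "\<And>j. j < k \<Longrightarrow> expectation (D (j + k)) = \<mu> j"
    and V: "\<And>j. j < 2 * k \<Longrightarrow> variance (D j) \<le> v"
  defines "T \<equiv> \<lambda>\<omega>. \<Sum>j<k. D j \<omega> * D (j + k) \<omega>"
  shows integrable_split_sum_sq: "integrable M (\<lambda>\<omega>. (T \<omega>)\<^sup>2)"
    and expectation_split_sum: "expectation T = (\<Sum>j<k. (\<mu> j)\<^sup>2)"
    and variance_split_sum: "variance T \<le> 2 * v * (\<Sum>j<k. (\<mu> j)\<^sup>2) + k * v\<^sup>2"
proof -
  have pair: "indep_var borel (D j) borel (D (j + k))" if "j < k" for j
  proof -
    have "indep_var borel ((\<lambda>x. x j) \<circ> (\<lambda>\<omega>. restrict (\<lambda>i. D i \<omega>) {j}))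
       borel ((\<lambda>x. x (j + k)) \<circ> (\<lambda>\<omega>. restrict (\<lambda>i. D i \<omega>) {j + k}))"
      using that by (intro indep_var_compose[OF indep_var_restrict[OF ind]]) auto
    then show ?thesis by (simp add: comp_def)
  qed
  \<comment> \<open>The index pairs \<open>{j, j + k}\<close> with \<open>j < k\<close> are
    disjoint, so the products inherit independence from the whole family.\<close>
  have indT: "indep_vars (\<lambda>_. borel) (\<lambda>j \<omega>. D j \<omega> * D (j + k) \<omega>) {..<k}"
  proof -
    have "indep_vars (\<lambda>_. borel)
        (\<lambda>j \<omega>. (\<lambda>x. x j * x (j + k)) (restrict (\<lambda>i. D i \<omega>) {j, j + k})) {..<k}"
      by (intro indep_vars_compose2[OF indep_vars_restrict[OF ind]] borel_measurable_times
          measurable_component_singleton) (auto simp: disjoint_family_on_def)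
    then show ?thesis by simp
  qed
  have sqT: "integrable M (\<lambda>\<omega>. (D j \<omega> * D (j + k) \<omega>)\<^sup>2)" if "j < k" for j
    using that by (intro integrable_indep_mult_sq[OF pair] sq) auto
  show "integrable M (\<lambda>\<omega>. (T \<omega>)\<^sup>2)"
    unfolding T_def by (intro integrable_indep_sum_sq[OF _ indT] sqT) auto
  have int: "integrable M (D j)" if "j < 2 * k" for j
  proof (rule square_integrable_imp_integrable)
    show "random_variable borel (D j)"
      using ind that unfolding indep_vars_def by blast
  qed (rule sq[OF that])
  have "expectation T = (\<Sum>j<k. expectation (\<lambda>\<omega>. D j \<omega> * D (j + k) \<omega>))"
    unfolding T_def using int
    by (intro Bochner_Integration.integral_sum indep_var_integrable[OF pair]) auto
  also have "\<dots> = (\<Sum>j<k. (\<mu> j)\<^sup>2)"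
    using int E by (intro sum.cong refl)
      (simp add: indep_var_lebesgue_integral[OF pair] power2_eq_square)
  finally show "expectation T = (\<Sum>j<k. (\<mu> j)\<^sup>2)" .
  have "variance T = (\<Sum>j<k. variance (\<lambda>\<omega>. D j \<omega> * D (j + k) \<omega>))"
    unfolding T_def by (intro variance_indep_sum[OF _ indT] sqT) auto
  also have "\<dots> \<le> (\<Sum>j<k. v * v + (\<mu> j)\<^sup>2 * v + (\<mu> j)\<^sup>2 * v)"
  proof (intro sum_mono)
    fix j assume "j \<in> {..<k}"
    then have j: "j < k" by simp
    have V': "variance (D j) \<le> v" "variance (D (j + k)) \<le> v"
      using j by (auto intro!: V)
    \<comment> \<open>Nonnegativity of \<open>v\<close> comes from the variance it bounds. This is
      available for each summand, so \<open>k = 0\<close> needs no separate case.\<close>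
    have v: "0 \<le> v"
      using V'(1) variance_positive order_trans by blast
    have "variance (\<lambda>\<omega>. D j \<omega> * D (j + k) \<omega>) = variance (D j) * variance (D (j + k)) +
        (expectation (D j))\<^sup>2 * variance (D (j + k)) + (expectation (D (j + k)))\<^sup>2 * variance (D j)"
      using j by (intro variance_indep_mult[OF pair] sq) auto
    also have "\<dots> \<le> v * v + (expectation (D j))\<^sup>2 * v + (expectation (D (j + k)))\<^sup>2 * v"
      by (intro add_mono mult_mono mult_left_mono V' v zero_le_power2 variance_positive order_refl)
    finally show "variance (\<lambda>\<omega>. D j \<omega> * D (j + k) \<omega>) \<le> v * v + (\<mu> j)\<^sup>2 * v + (\<mu> j)\<^sup>2 * v"
      using j E by simp
  qed
  also have "\<dots> = 2 * v * (\<Sum>j<k. (\<mu> j)\<^sup>2) + k * v\<^sup>2"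
    by (simp add: sum.distrib sum_distrib_right[symmetric] power2_eq_square)
      (simp add: sum_distrib_left mult_ac)
  finally show "variance T \<le> 2 * v * (\<Sum>j<k. (\<mu> j)\<^sup>2) + k * v\<^sup>2" .
qed

end

section \<open>Product measures as laws of independent families\<close>

lemma indep_vars_PiM_components:
  assumes "\<And>i. i \<in> I \<Longrightarrow> prob_space (N i)" "I \<noteq> {}"
  shows "prob_space.indep_vars (PiM I N) N (\<lambda>i \<omega>. \<omega> i) I"
proof -
  interpret P: prob_space "PiM I N" by (rule prob_space_PiM) fact
  \<comment> \<open>Points of the product space are extensional on \<open>I\<close>, so restricting
    to \<open>I\<close> is the identity there. The joint law of the coordinates is then the product
    of their marginals, which characterises independence.\<close>
  have "distr (PiM I N) (PiM I N) (\<lambda>\<omega>. \<lambda>i\<in>I. \<omega> i) = distr (PiM I N) (PiM I N) (\<lambda>\<omega>. \<omega>)"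
    by (intro distr_cong) (auto simp: space_PiM)
  also have "\<dots> = (\<Pi>\<^sub>M i\<in>I. distr (PiM I N) (N i) (\<lambda>\<omega>. \<omega> i))"
    using assms by (simp add: distr_PiM_component cong: PiM_cong)
  finally show ?thesis
    using assms by (subst P.indep_vars_iff_distr_eq_PiM') auto
qed

text \<open>Moves the messages of both groups to one product space over \<open>I <+> J\<close>,
  where they form a single independent family. The restrictions to the two disjoint halves are
  independent, so their joint law is the product of their laws, and reindexing along
  \<open>Inl\<close> and \<open>Inr\<close> identifies each factor.\<close>

lemma pair_PiM_eq_distr_PiM_Plus:
  fixes I :: "'i set" and J :: "'i set" and M1 :: "'i \<Rightarrow> 'a measure"
  assumes "\<And>i. i \<in> I \<Longrightarrow> prob_space (M1 i)" "\<And>j. j \<in> J \<Longrightarrow> prob_space (M2 j)"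
    and ne: "I \<noteq> {}"
  shows "PiM I M1 \<Otimes>\<^sub>M PiM J M2 = distr (PiM (I <+> J) (case_sum M1 M2)) (PiM I M1 \<Otimes>\<^sub>M PiM J M2)
    (\<lambda>\<omega>. (\<lambda>i\<in>I. \<omega> (Inl i), \<lambda>j\<in>J. \<omega> (Inr j)))"
proof -
  let ?M = "case_sum M1 M2"
  have ps: "\<And>i. i \<in> I <+> J \<Longrightarrow> prob_space (?M i)" using assms by auto
  interpret P: prob_space "PiM (I <+> J) ?M" by (rule prob_space_PiM) fact
  have ind: "P.indep_vars ?M (\<lambda>i \<omega>. \<omega> i) (I <+> J)"
    using ne by (intro indep_vars_PiM_components ps) auto
  have "P.indep_var (PiM I M1) ((\<lambda>\<omega>. \<lambda>i\<in>I. \<omega> (Inl i)) \<circ> (\<lambda>\<omega>. restrict \<omega> (Inl ` I)))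
      (PiM J M2) ((\<lambda>\<omega>. \<lambda>j\<in>J. \<omega> (Inr j)) \<circ> (\<lambda>\<omega>. restrict \<omega> (Inr ` J)))"
  proof (rule P.indep_var_compose)
    show "P.indep_var (PiM (Inl ` I) ?M) (\<lambda>\<omega>. restrict \<omega> (Inl ` I))
        (PiM (Inr ` J) ?M) (\<lambda>\<omega>. restrict \<omega> (Inr ` J))"
      by (rule P.indep_var_restrict[OF ind]) auto
    show "(\<lambda>\<omega>. \<lambda>i\<in>I. \<omega> (Inl i)) \<in> PiM (Inl ` I) ?M \<rightarrow>\<^sub>M PiM I M1"
      by (rule measurable_restrict)
        (use measurable_component_singleton[of "Inl i" "Inl ` I" ?M for i] in simp)
    show "(\<lambda>\<omega>. \<lambda>j\<in>J. \<omega> (Inr j)) \<in> PiM (Inr ` J) ?M \<rightarrow>\<^sub>M PiM J M2"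
      by (rule measurable_restrict)
        (use measurable_component_singleton[of "Inr i" "Inr ` J" ?M for i] in simp)
  qed
  then have "P.indep_var (PiM I M1) (\<lambda>\<omega>. \<lambda>i\<in>I. \<omega> (Inl i)) (PiM J M2) (\<lambda>\<omega>. \<lambda>j\<in>J. \<omega> (Inr j))"
    by (simp add: comp_def cong: restrict_cong)
  then have "distr (PiM (I <+> J) ?M) (PiM I M1) (\<lambda>\<omega>. \<lambda>i\<in>I. \<omega> (Inl i)) \<Otimes>\<^sub>M
      distr (PiM (I <+> J) ?M) (PiM J M2) (\<lambda>\<omega>. \<lambda>j\<in>J. \<omega> (Inr j)) =
    distr (PiM (I <+> J) ?M) (PiM I M1 \<Otimes>\<^sub>M PiM J M2)
      (\<lambda>\<omega>. (\<lambda>i\<in>I. \<omega> (Inl i), \<lambda>j\<in>J. \<omega> (Inr j)))"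
    unfolding P.indep_var_distribution_eq by simp
  also have "distr (PiM (I <+> J) ?M) (PiM I M1) (\<lambda>\<omega>. \<lambda>i\<in>I. \<omega> (Inl i)) = PiM I M1"
    using distr_PiM_reindex[of "I <+> J" ?M Inl I, OF ps] by (simp add: Pi_iff InlI InrI)
  also have "distr (PiM (I <+> J) ?M) (PiM J M2) (\<lambda>\<omega>. \<lambda>j\<in>J. \<omega> (Inr j)) = PiM J M2"
    using distr_PiM_reindex[of "I <+> J" ?M Inr J, OF ps] by (simp add: Pi_iff InlI InrI)
  finally show ?thesis .
qed

section \<open>Roots of unity and the Hartley transform\<close>

lemma sum_cis_roots_of_unity:
  assumes "k > 0"
  shows "(\<Sum>j<k. cis (2 * pi * real j * of_int s / real k)) = (if int k dvd s then of_nat k else 0)"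
proof -
  define w where "w = cis (2 * pi * of_int s / real k)"
  have pow: "cis (2 * pi * real j * of_int s / real k) = w ^ j" for j
    unfolding w_def by (simp add: Complex.DeMoivre mult_ac)
  have wk: "w ^ k = 1"
    using assms cis_multiple_2pi[of "of_int s"] unfolding w_def by (simp add: Complex.DeMoivre)
  show ?thesis
  proof (cases "int k dvd s")
    case True
    then obtain n where "s = int k * n" ..
    then have "w = 1"
      using assms cis_multiple_2pi[of "of_int n"] by (simp add: w_def mult_ac)
    then show ?thesis using True by (simp add: pow)
  next
    case False
    have "w \<noteq> 1"
    proof
      assume "w = 1"
      then have "cos (2 * pi * of_int s / real k) = 1"
        unfolding w_def by (simp add: complex_eq_iff)
      then obtain n :: int where "2 * pi * of_int s / real k = of_int n * 2 * pi"
        by (auto simp: cos_one_2pi_int)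
      then have "real_of_int s = of_int (n * int k)"
        using assms by (simp add: field_simps)
      then have "s = n * int k" by linarith
      then show False using False by simp
    qed
    \<comment> \<open>Geometric series: \<open>(w - 1)\<close> times the sum is
      \<open>w ^ k - 1\<close>, which vanishes, while \<open>w - 1\<close> does not.\<close>
    moreover have "(w - 1) * (\<Sum>j<k. w ^ j) = 0"
      using power_diff_1_eq[of w k] wk by simp
    ultimately show ?thesis using False by (simp add: pow)
  qed
qed

text \<open>
  The Hartley basis: a real orthogonal system of size exactly \<open>k\<close> with bounded entries,
  available for every \<open>k\<close> (a Hadamard matrix would need a power of two).
\<close>

definition hartley :: "nat \<Rightarrow> nat \<Rightarrow> nat \<Rightarrow> real" where
  "hartley k j x = cos (2 * pi * real j * real x / real k) + sin (2 * pi * real j * real x / real k)"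

lemma abs_hartley_le: "\<bar>hartley k j x\<bar> \<le> 2"
  unfolding hartley_def
  using abs_cos_le_one[of "2 * pi * real j * real x / real k"]
    abs_sin_le_one[of "2 * pi * real j * real x / real k"] by linarith

text \<open>Since \<open>x\<close> is an integer, changing the frequency by a multiple of
  \<open>k\<close> changes the angle by a multiple of \<open>2 * pi\<close>. User \<open>i\<close>
  can therefore use frequency \<open>i\<close> directly, and users congruent modulo \<open>k\<close>
  measure the same coefficient.\<close>

lemma hartley_mod: "hartley k (j mod k) x = hartley k j x"
proof (cases "k = 0")
  case False
  have "real j = real (j mod k) + real k * real (j div k)"
    by (metis mult_div_mod_eq add.commute of_nat_add of_nat_mult)
  then have "2 * pi * real j * real x / real k =
      2 * pi * real (j mod k) * real x / real k + 2 * pi * of_int (int (j div k * x))"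
    using False by (simp add: field_simps)
  then show ?thesis
    unfolding hartley_def using cos_int_2pin[of "int (j div k * x)"] sin_int_2pin[of "int (j div k * x)"]
    by (simp only: cos_add sin_add)
qed (simp add: hartley_def)

text \<open>The identity (cos a + sin a)(cos b + sin b) = cos(a - b) + sin(a + b) turns the sum into
  the real part of one sum of roots of unity plus the imaginary part of another.\<close>

lemma hartley_orthogonal:
  assumes "x \<in> {1..k}" "y \<in> {1..k}"
  shows "(\<Sum>j<k. hartley k j x * hartley k j y) = (if x = y then real k else 0)"
proof -
  have k: "k > 0" using assms by auto
  let ?c = "\<lambda>s j. cis (2 * pi * real j * of_int s / real k)"
  have "hartley k j x * hartley k j y = Re (?c (int x - int y) j) + Im (?c (int x + int y) j)" for j
  proof -
    define a where "a = 2 * pi * real j * real x / real k"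
    define b where "b = 2 * pi * real j * real y / real k"
    have "2 * pi * real j * of_int (int x - int y) / real k = a - b"
      "2 * pi * real j * of_int (int x + int y) / real k = a + b"
      using k by (simp_all add: a_def b_def diff_divide_distrib add_divide_distrib algebra_simps)
    then show ?thesis
      unfolding hartley_def a_def[symmetric] b_def[symmetric]
      by (simp only: cis.sel cos_diff sin_add) (simp only: algebra_simps)
  qed
  then have "(\<Sum>j<k. hartley k j x * hartley k j y) =
      Re (\<Sum>j<k. ?c (int x - int y) j) + Im (\<Sum>j<k. ?c (int x + int y) j)"
    by (simp only: sum.distrib Re_sum Im_sum)
  \<comment> \<open>The sum for \<open>x + y\<close> is \<open>k\<close> or 0, so it is real and its
    imaginary part vanishes even when \<open>k\<close> divides \<open>x + y\<close>.\<close>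
  also have "\<dots> = (if int k dvd int x - int y then real k else 0)"
    unfolding sum_cis_roots_of_unity[OF k] by simp
  also have "int k dvd int x - int y \<longleftrightarrow> x = y"
  proof -
    \<comment> \<open>Both points lie in \<open>{1..k}\<close>, so their distance is below
      \<open>k\<close> and only 0 is a possible multiple.\<close>
    have "\<not> int k \<le> \<bar>int x - int y\<bar>" using assms by auto
    then show ?thesis using zdvd_imp_le[of "int k" "\<bar>int x - int y\<bar>"] by force
  qed
  finally show ?thesis .
qed

text \<open>After expanding the squares and summing over the frequencies first, orthogonality leaves
  only the diagonal terms, each with weight \<open>k\<close>.\<close>

lemma hartley_parseval:
  "(\<Sum>j<k. (\<Sum>x\<in>{1..k}. hartley k j x * d x)\<^sup>2) = real k * (\<Sum>x\<in>{1..k}. (d x)\<^sup>2)"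
proof -
  have "(\<Sum>j<k. (\<Sum>x\<in>{1..k}. hartley k j x * d x)\<^sup>2) =
      (\<Sum>j<k. \<Sum>x\<in>{1..k}. \<Sum>y\<in>{1..k}. d x * d y * (hartley k j x * hartley k j y))"
    unfolding power2_eq_square sum_product by (simp add: mult_ac)
  also have "\<dots> = (\<Sum>x\<in>{1..k}. \<Sum>j<k. \<Sum>y\<in>{1..k}. d x * d y * (hartley k j x * hartley k j y))"
    by (rule sum.swap)
  also have "\<dots> = (\<Sum>x\<in>{1..k}. \<Sum>y\<in>{1..k}. \<Sum>j<k. d x * d y * (hartley k j x * hartley k j y))"
    by (intro sum.cong refl sum.swap)
  also have "\<dots> = (\<Sum>x\<in>{1..k}. \<Sum>y\<in>{1..k}. d x * d y * (if x = y then real k else 0))"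
    by (intro sum.cong refl) (simp add: sum_distrib_left[symmetric] hartley_orthogonal)
  also have "\<dots> = real k * (\<Sum>x\<in>{1..k}. (d x)\<^sup>2)"
    by (simp add: if_distrib[of "\<lambda>r. _ * r"] sum.delta' sum_distrib_left power2_eq_square mult_ac cong: if_cong)
  finally show ?thesis .
qed

text \<open>Twice the distance is the l1 norm of the difference. Comparing it with the l2 norm by
  Cauchy-Schwarz costs a factor \<open>k\<close>, which is exactly the factor in
  \<open>hartley_parseval\<close>.\<close>

lemma tv_dist_le_hartley:
  "(2 * tv_dist k p q)\<^sup>2 \<le>
    (\<Sum>j<k. ((\<Sum>x\<in>{1..k}. hartley k j x * measure p {x}) - (\<Sum>x\<in>{1..k}. hartley k j x * measure q {x}))\<^sup>2)"
proof -
  let ?d = "\<lambda>x. measure p {x} - measure q {x}"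
  have "(2 * tv_dist k p q)\<^sup>2 = (\<Sum>x\<in>{1..k}. \<bar>?d x\<bar> * 1)\<^sup>2"
    unfolding tv_dist_def by simp
  also have "\<dots> \<le> (\<Sum>x\<in>{1..k}. \<bar>?d x\<bar>\<^sup>2) * (\<Sum>x\<in>{1..k}. 1\<^sup>2)"
    by (rule Cauchy_Schwarz_ineq_sum)
  also have "\<dots> = (\<Sum>j<k. (\<Sum>x\<in>{1..k}. hartley k j x * ?d x)\<^sup>2)"
    unfolding hartley_parseval by simp
  finally show ?thesis
    by (simp add: right_diff_distrib sum_subtractf)
qed

section \<open>Random signs and the private messages\<close>

definition random_sign :: "real \<Rightarrow> real measure" where
  "random_sign r = distr (measure_pmf (bernoulli_pmf ((1 + r) / 2))) borel (\<lambda>b. if b then 1 else - 1)"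

text \<open>No bound on \<open>r\<close> is required because \<open>bernoulli_pmf\<close> clamps its
  parameter to the unit interval; the bound matters only for the mean and the point masses.\<close>

lemma prob_space_random_sign: "prob_space (random_sign r)"
  unfolding random_sign_def by (rule measure_pmf.prob_space_distr) simp

lemma sets_random_sign [simp, measurable_cong]: "sets (random_sign r) = sets borel"
  unfolding random_sign_def by simp

lemma integral_sgn_random_sign:
  assumes "\<bar>r\<bar> \<le> 1"
  shows "(\<integral>y. sgn y \<partial>random_sign r) = r"
  unfolding random_sign_def using assms by (subst integral_distr) (auto simp: field_simps)

lemma measure_random_sign:
  assumes "\<bar>r\<bar> \<le> 1" "S \<in> sets borel"
  shows "measure (random_sign r) S = (1 + r) / 2 * indicator S 1 + (1 - r) / 2 * indicator S (- 1)"
proof -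
  have "measure (random_sign r) S = (\<integral>y. indicator S y \<partial>random_sign r)"
    using assms by (simp add: random_sign_def)
  also have "\<dots> = (1 + r) / 2 * indicator S 1 + (1 - r) / 2 * indicator S (- 1)"
    unfolding random_sign_def using assms
    by (subst integral_distr) (auto simp: field_simps)
  finally show ?thesis .
qed

text \<open>Each sign has probability between (1 - \<epsilon>/3)/2 and (1 + \<epsilon>/3)/2, so it
  suffices to bound the ratio of these extremes by exp \<epsilon>; arbitrary events follow by adding
  the two atoms.\<close>

lemma random_sign_ldp:
  assumes \<epsilon>: "0 \<le> \<epsilon>" "\<epsilon> \<le> 1" and r: "\<bar>r\<bar> \<le> \<epsilon> / 3" "\<bar>r'\<bar> \<le> \<epsilon> / 3" and S: "S \<in> sets borel"
  shows "measure (random_sign r) S \<le> exp \<epsilon> * measure (random_sign r') S"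
proof -
  have e: "1 + \<epsilon> \<le> exp \<epsilon>" by (rule exp_ge_add_one_self)
  have key: "1 + \<epsilon> / 3 \<le> exp \<epsilon> * (1 - \<epsilon> / 3)"
  proof -
    \<comment> \<open>This is where \<epsilon> at most 1 enters: it gives \<epsilon> * \<epsilon> at
      most \<epsilon>.\<close>
    have "1 + \<epsilon> / 3 \<le> 1 + \<epsilon> - \<epsilon> / 3 - \<epsilon> * \<epsilon> / 3"
      using mult_left_mono[of \<epsilon> 1 \<epsilon>] \<epsilon> by simp
    also have "\<dots> = (1 + \<epsilon>) * (1 - \<epsilon> / 3)"
      by (simp add: field_simps)
    also have "\<dots> \<le> exp \<epsilon> * (1 - \<epsilon> / 3)"
      using e \<epsilon> by (intro mult_right_mono) auto
    finally show ?thesis .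
  qed
  have "exp \<epsilon> * (1 - \<epsilon> / 3) \<le> exp \<epsilon> * (1 + r')" "exp \<epsilon> * (1 - \<epsilon> / 3) \<le> exp \<epsilon> * (1 - r')"
    using r by auto
  then have "1 + r \<le> exp \<epsilon> * (1 + r')" "1 - r \<le> exp \<epsilon> * (1 - r')"
    using key r by linarith+
  then have "(1 + r) / 2 * indicator S 1 + (1 - r) / 2 * indicator S (- 1)
      \<le> exp \<epsilon> * (1 + r') / 2 * indicator S 1 + exp \<epsilon> * (1 - r') / 2 * indicator S (- 1 :: real)"
    by (intro add_mono mult_right_mono) auto
  also have "\<dots> = exp \<epsilon> * ((1 + r') / 2 * indicator S 1 + (1 - r') / 2 * indicator S (- 1))"
    by (simp add: algebra_simps)
  finally show ?thesis
    using r \<epsilon> S by (simp add: measure_random_sign)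
qed

definition hartley_message :: "nat \<Rightarrow> real \<Rightarrow> nat \<Rightarrow> nat \<Rightarrow> real measure" where
  "hartley_message k c i x = random_sign (c * hartley k i x)"

lemma hartley_message_measurable:
  "hartley_message k c i \<in> domain_space k \<rightarrow>\<^sub>M prob_algebra borel"
  by (auto simp: hartley_message_def space_prob_algebra prob_space_random_sign)

lemma
  assumes p: "distribution_over k p" and c: "0 \<le> c" "2 * c \<le> 1"
  shows prob_space_hartley_message: "prob_space (p \<bind> hartley_message k c i)"
    and sets_hartley_message: "sets (p \<bind> hartley_message k c i) = sets borel"
    and integral_hartley_message:
      "(\<integral>y. sgn y \<partial>(p \<bind> hartley_message k c i)) = c * (\<Sum>x\<in>{1..k}. hartley k i x * measure p {x})"
proof -
  have p': "p \<in> space (prob_algebra (domain_space k))"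
    using p by (simp add: distribution_over_def)
  then have P: "prob_space p" and sets: "sets p = sets (domain_space k)"
    by (auto simp: space_prob_algebra)
  interpret prob_space p by fact
  have space: "space p = {1..k}" using sets_eq_imp_space_eq[OF sets] by simp
  have m': "hartley_message k c i \<in> p \<rightarrow>\<^sub>M subprob_algebra borel"
    using measurable_prob_algebraD[OF hartley_message_measurable]
      measurable_cong_sets[OF sets refl] by blast
  show "prob_space (p \<bind> hartley_message k c i)"
    by (rule prob_space_bind'[OF p' hartley_message_measurable])
  show "sets (p \<bind> hartley_message k c i) = sets borel"
    by (rule sets_bind'[OF p' hartley_message_measurable])
  \<comment> \<open>The entries are at most 2 in absolute value, so \<open>2 * c \<le> 1\<close>
    keeps the bias in the range where it equals the mean of the sign.\<close>
  have r: "\<bar>c * hartley k i x\<bar> \<le> 1" for x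
    using mult_left_mono[OF abs_hartley_le[of k i x] c(1)] c by (simp add: abs_mult)
  \<comment> \<open>\<open>integral_bind\<close> asks for a bounded integrand, which
    \<open>sgn\<close> is on all reals.\<close>
  have "(\<integral>y. sgn y \<partial>(p \<bind> hartley_message k c i)) = (\<integral>x. (\<integral>y. sgn y \<partial>hartley_message k c i x) \<partial>p)"
    by (rule integral_bind[where K=borel and B=1 and B'=1, OF _ _ m'])
      (auto simp: abs_sgn_eq hartley_message_def prob_space.emeasure_space_1[OF prob_space_random_sign]
        intro: finite_measure_axioms)
  also have "\<dots> = (\<integral>x. c * hartley k i x \<partial>p)"
    using r by (simp add: hartley_message_def integral_sgn_random_sign)
  also have "\<dots> = (\<integral>x. c * hartley k i x * indicator {1..k} x \<partial>p)"
    by (intro Bochner_Integration.integral_cong) (auto simp: space)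
  also have "\<dots> = (\<Sum>x\<in>{1..k}. c * hartley k i x * measure p {x})"
    by (intro integral_indicator_finite_real) (auto simp: sets less_top[symmetric])
  finally show "(\<integral>y. sgn y \<partial>(p \<bind> hartley_message k c i)) = c * (\<Sum>x\<in>{1..k}. hartley k i x * measure p {x})"
    by (simp add: sum_distrib_left mult_ac)
qed

section \<open>Blocks of users and concentration of the statistic\<close>

definition block :: "nat \<Rightarrow> nat \<Rightarrow> nat \<Rightarrow> nat set" where
  "block k m g = (\<lambda>t. g + 2 * k * t) ` {..<m}"

lemma finite_block [simp]: "finite (block k m g)"
  by (simp add: block_def)

lemma card_block: "k > 0 \<Longrightarrow> card (block k m g) = m"
  unfolding block_def by (subst card_image) (auto simp: inj_on_def)

text \<open>Distinct residues modulo \<open>2 * k\<close> make the blocks disjoint. For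
  \<open>g < k\<close> the blocks \<open>g\<close> and \<open>g + k\<close> agree modulo
  \<open>k\<close> and so measure the same coefficient; they are the two halves multiplied in
  \<open>split_stat\<close>.\<close>

lemma block_mod: "g < 2 * k \<Longrightarrow> i \<in> block k m g \<Longrightarrow> i mod (2 * k) = g"
  by (auto simp: block_def)

lemma block_subset:
  assumes "g < 2 * k"
  shows "block k m g \<subseteq> {..<2 * k * m}"
proof
  fix i assume "i \<in> block k m g"
  then obtain t where i: "i = g + 2 * k * t" and t: "t < m" by (auto simp: block_def)
  have "i < 2 * k * Suc t" using assms i by simp
  also have "\<dots> \<le> 2 * k * m" using t by (intro mult_le_mono2) auto
  finally show "i \<in> {..<2 * k * m}" by simp
qed

text \<open>
  Messages are signs almost surely only, since the message space is all of \<open>\<real>\<close>; applying \<open>sgn\<close>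
  makes the statistic bounded everywhere.
\<close>

definition block_diff ::
    "nat \<Rightarrow> real \<Rightarrow> real \<Rightarrow> nat \<Rightarrow> nat \<Rightarrow> (nat \<Rightarrow> real) \<Rightarrow> (nat \<Rightarrow> real) \<Rightarrow> nat \<Rightarrow> real" where
  "block_diff k c\<^sub>1 c\<^sub>2 m\<^sub>1 m\<^sub>2 y z g =
     (\<Sum>i\<in>block k m\<^sub>1 g. sgn (y i)) / (c\<^sub>1 * m\<^sub>1) - (\<Sum>i\<in>block k m\<^sub>2 g. sgn (z i)) / (c\<^sub>2 * m\<^sub>2)"

definition split_stat ::
    "nat \<Rightarrow> real \<Rightarrow> real \<Rightarrow> nat \<Rightarrow> nat \<Rightarrow> (nat \<Rightarrow> real) \<times> (nat \<Rightarrow> real) \<Rightarrow> real" where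
  "split_stat k c\<^sub>1 c\<^sub>2 m\<^sub>1 m\<^sub>2 = (\<lambda>(y, z).
     \<Sum>j<k. block_diff k c\<^sub>1 c\<^sub>2 m\<^sub>1 m\<^sub>2 y z j * block_diff k c\<^sub>1 c\<^sub>2 m\<^sub>1 m\<^sub>2 y z (j + k))"

lemma split_stat_measurable:
  "split_stat k c\<^sub>1 c\<^sub>2 m\<^sub>1 m\<^sub>2 \<in>
    (\<Pi>\<^sub>M i\<in>{..<2 * k * m\<^sub>1}. borel) \<Otimes>\<^sub>M (\<Pi>\<^sub>M i\<in>{..<2 * k * m\<^sub>2}. borel) \<rightarrow>\<^sub>M borel"
proof -
  let ?Q = "(\<Pi>\<^sub>M i\<in>{..<2 * k * m\<^sub>1}. borel) \<Otimes>\<^sub>M (\<Pi>\<^sub>M i\<in>{..<2 * k * m\<^sub>2}. borel) :: ((nat \<Rightarrow> real) \<times> (nat \<Rightarrow> real)) measure"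
  have 1: "(\<lambda>x. fst x i) \<in> borel_measurable ?Q" if "g < 2 * k" "i \<in> block k m\<^sub>1 g" for g i
    using block_subset that
    by (intro measurable_compose[OF measurable_fst measurable_component_singleton]) blast
  have 2: "(\<lambda>x. snd x i) \<in> borel_measurable ?Q" if "g < 2 * k" "i \<in> block k m\<^sub>2 g" for g i
    using block_subset that
    by (intro measurable_compose[OF measurable_snd measurable_component_singleton]) blast
  have "(\<lambda>x. block_diff k c\<^sub>1 c\<^sub>2 m\<^sub>1 m\<^sub>2 (fst x) (snd x) g) \<in> borel_measurable ?Q"
    if "g < 2 * k" for g
    unfolding block_diff_def
    by (intro borel_measurable_diff borel_measurable_divide borel_measurable_sum
        measurable_compose[OF _ borel_measurable_sgn] borel_measurable_const 1[OF that] 2[OF that])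
  then show ?thesis
    unfolding split_stat_def case_prod_beta
    by (intro borel_measurable_sum borel_measurable_times) auto
qed

text \<open>Chebyshev's inequality for the split statistic. A block of \<open>m\<^sub>1\<close>
  signs, each of variance at most 1 and scaled by \<open>1 / (c\<^sub>1 * m\<^sub>1)\<close>,
  contributes at most \<open>1 / (m\<^sub>1 * c\<^sub>1\<^sup>2)\<close>; with the second group this
  gives the variance bound \<open>v\<close> for one block difference, whose mean is
  \<open>a j - b j\<close> in both halves.\<close>

lemma split_stat_concentration:
  fixes N\<^sub>1 N\<^sub>2 :: "nat \<Rightarrow> real measure" and a b :: "nat \<Rightarrow> real" and k m\<^sub>1 m\<^sub>2 :: nat and c\<^sub>1 c\<^sub>2 r S v :: real
  defines "Q \<equiv> PiM {..<2 * k * m\<^sub>1} N\<^sub>1 \<Otimes>\<^sub>M PiM {..<2 * k * m\<^sub>2} N\<^sub>2"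
    and "S \<equiv> \<Sum>j<k. (a j - b j)\<^sup>2"
    and "v \<equiv> 1 / (m\<^sub>1 * c\<^sub>1\<^sup>2) + 1 / (m\<^sub>2 * c\<^sub>2\<^sup>2)"
  assumes pos: "k > 0" "m\<^sub>1 > 0" "m\<^sub>2 > 0" "c\<^sub>1 > 0" "c\<^sub>2 > 0" "r > 0"
    and N1: "\<And>i. prob_space (N\<^sub>1 i)" "\<And>i. sets (N\<^sub>1 i) = sets borel"
      "\<And>i. (\<integral>y. sgn y \<partial>N\<^sub>1 i) = c\<^sub>1 * a (i mod k)"
    and N2: "\<And>i. prob_space (N\<^sub>2 i)" "\<And>i. sets (N\<^sub>2 i) = sets borel"
      "\<And>i. (\<integral>y. sgn y \<partial>N\<^sub>2 i) = c\<^sub>2 * b (i mod k)"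
  shows "measure Q {\<omega>\<in>space Q. \<bar>split_stat k c\<^sub>1 c\<^sub>2 m\<^sub>1 m\<^sub>2 \<omega> - S\<bar> \<ge> r} \<le> (2 * v * S + k * v\<^sup>2) / r\<^sup>2"
proof -
  let ?I = "{..<2 * k * m\<^sub>1}" and ?J = "{..<2 * k * m\<^sub>2}"
  let ?N = "case_sum N\<^sub>1 N\<^sub>2"
  let ?P = "PiM (?I <+> ?J) ?N"
  let ?T = "split_stat k c\<^sub>1 c\<^sub>2 m\<^sub>1 m\<^sub>2"
  define \<phi> where "\<phi> = (\<lambda>\<omega> :: nat + nat \<Rightarrow> real. (\<lambda>i\<in>?I. \<omega> (Inl i), \<lambda>j\<in>?J. \<omega> (Inr j)))"
  \<comment> \<open>Normalisation and the sign of the second group are put into the coefficients, so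
    that a block difference becomes one sum of independent terms.\<close>
  define c where "c = case_sum (\<lambda>_ :: nat. 1 / (c\<^sub>1 * m\<^sub>1)) (\<lambda>_ :: nat. - (1 / (c\<^sub>2 * m\<^sub>2)))"
  define X where "X = (\<lambda>i (\<omega> :: nat + nat \<Rightarrow> real). c i * sgn (\<omega> i))"
  define K where "K = (\<lambda>g. block k m\<^sub>1 g <+> block k m\<^sub>2 g)"
  define D where "D = (\<lambda>g \<omega>. \<Sum>i\<in>K g. X i \<omega>)"
  define \<mu> where "\<mu> = (\<lambda>j. a j - b j)"
  have ps: "prob_space (?N i)" and sets_N: "sets (?N i) = sets borel" for i
    using N1 N2 by (auto split: sum.split)
  interpret P: prob_space ?P by (rule prob_space_PiM) (rule ps)
  have Q: "Q = distr ?P Q \<phi>"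
    unfolding Q_def \<phi>_def using pos by (intro pair_PiM_eq_distr_PiM_Plus N1 N2) (auto simp: lessThan_empty_iff)
  have \<phi>: "\<phi> \<in> ?P \<rightarrow>\<^sub>M Q"
    unfolding \<phi>_def Q_def
    by (intro measurable_Pair measurable_restrict;
        use measurable_component_singleton[of "Inl i" "?I <+> ?J" ?N for i]
          measurable_component_singleton[of "Inr i" "?I <+> ?J" ?N for i] in force)
  have Ksub: "K g \<subseteq> ?I <+> ?J" if "g < 2 * k" for g
    unfolding K_def using block_subset[OF that] by auto
  have disj: "disjoint_family_on K {..<2 * k}"
    unfolding K_def disjoint_family_on_def by (auto dest: block_mod)
  have X_meas: "X i \<in> borel_measurable ?P" if "i \<in> ?I <+> ?J" for i
  proof -
    have "(\<lambda>\<omega>. \<omega> i) \<in> ?P \<rightarrow>\<^sub>M ?N i"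
      using that by (rule measurable_component_singleton)
    then have "(\<lambda>\<omega>. \<omega> i) \<in> borel_measurable ?P"
      unfolding measurable_cong_sets[OF refl sets_N] .
    then show ?thesis
      unfolding X_def by measurable
  qed
  \<comment> \<open>The bound holds everywhere, thanks to \<open>sgn\<close>, and supplies all the
    integrability needed below.\<close>
  have X_bound: "\<bar>X i \<omega>\<bar> \<le> \<bar>c i\<bar>" for i \<omega>
    unfolding X_def by (simp add: abs_mult abs_sgn_eq)
  have X_sq: "(X i \<omega>)\<^sup>2 \<le> (c i)\<^sup>2" for i \<omega>
    using power_mono[OF X_bound[of i \<omega>] abs_ge_zero, of 2] by simp
  have X_int: "integrable ?P (X i)" if "i \<in> ?I <+> ?J" for i
    using X_bound[of i] X_meas[OF that]
    by (auto intro: P.integrable_const_bound[where B="\<bar>c i\<bar>"])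
  have X_int2: "integrable ?P (\<lambda>\<omega>. (X i \<omega>)\<^sup>2)" if "i \<in> ?I <+> ?J" for i
    using X_sq[of i] X_meas[OF that]
    by (auto intro: P.integrable_const_bound[where B="(c i)\<^sup>2"])
  have X_ind: "P.indep_vars (\<lambda>_. borel) X (?I <+> ?J)"
    unfolding X_def
  proof (rule P.indep_vars_compose2[where X="\<lambda>i \<omega>. \<omega> i" and M'="?N"])
    show "P.indep_vars ?N (\<lambda>i \<omega>. \<omega> i) (?I <+> ?J)"
      using pos by (intro indep_vars_PiM_components ps) (auto simp: lessThan_empty_iff)
    show "(\<lambda>y. c i * sgn y) \<in> ?N i \<rightarrow>\<^sub>M borel" for i
      unfolding measurable_cong_sets[OF sets_N refl] by measurable
  qed
  have X_E: "P.expectation (X i) = c i * (\<integral>y. sgn y \<partial>?N i)" if "i \<in> ?I <+> ?J" for i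
  proof -
    have "(\<integral>y. sgn y \<partial>?N i) = (\<integral>y. sgn y \<partial>distr ?P (?N i) (\<lambda>\<omega>. \<omega> i))"
      using that ps by (subst distr_PiM_component) auto
    also have "\<dots> = P.expectation (\<lambda>\<omega>. sgn (\<omega> i))"
    proof (rule integral_distr)
      show "(\<lambda>\<omega>. \<omega> i) \<in> ?P \<rightarrow>\<^sub>M ?N i"
        using that by (rule measurable_component_singleton)
      show "sgn \<in> borel_measurable (?N i)"
        unfolding measurable_cong_sets[OF sets_N refl] by measurable
    qed
    finally show ?thesis unfolding X_def by simp
  qed
  have X_var: "P.variance (X i) \<le> (c i)\<^sup>2" if "i \<in> ?I <+> ?J" for i
  proof -
    have "P.variance (X i) \<le> P.expectation (\<lambda>\<omega>. (X i \<omega>)\<^sup>2)"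
      using X_int[OF that] X_int2[OF that] by (subst P.variance_eq) auto
    also have "\<dots> \<le> (c i)\<^sup>2"
      using X_int2[OF that] X_sq by (intro P.integral_le_const) auto
    finally show ?thesis .
  qed
  have D_ind: "P.indep_vars (\<lambda>_. borel) D {..<2 * k}"
    unfolding D_def using Ksub disj by (intro P.indep_vars_block_sum[OF X_ind]) auto
  have K_ind: "P.indep_vars (\<lambda>_. borel) X (K g)" if "g < 2 * k" for g
    using P.indep_vars_subset[OF X_ind Ksub[OF that]] .
  have finK: "finite (K g)" for g
    unfolding K_def by simp
  have D_sq: "integrable ?P (\<lambda>\<omega>. (D g \<omega>)\<^sup>2)" if "g < 2 * k" for g
    unfolding D_def using Ksub[OF that] X_int2
    by (intro P.integrable_indep_sum_sq[OF finK K_ind[OF that]]) blast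
  have D_var: "P.variance (D g) \<le> v" if "g < 2 * k" for g
  proof -
    have "P.variance (D g) = (\<Sum>i\<in>K g. P.variance (X i))"
      unfolding D_def using Ksub[OF that] X_int2
      by (intro P.variance_indep_sum[OF finK K_ind[OF that]]) blast
    also have "\<dots> \<le> (\<Sum>i\<in>K g. (c i)\<^sup>2)"
      using Ksub[OF that] X_var by (intro sum_mono) blast
    also have "\<dots> = v"
      unfolding K_def v_def c_def using pos
      by (simp add: sum.Plus card_block power_divide power2_eq_square field_simps)
    finally show ?thesis .
  qed
  have D_E: "P.expectation (D g) = \<mu> (g mod k)" if g: "g < 2 * k" for g
  proof -
    \<comment> \<open>Blocks fix the residue modulo \<open>2 * k\<close>, hence also modulo its
      divisor \<open>k\<close>.\<close>
    have mod: "i mod k = g mod k" if "i \<in> block k m g" for i m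
      using block_mod[OF g that] by (metis mod_mod_cancel dvd_triv_right)
    have "P.expectation (D g) = (\<Sum>i\<in>K g. c i * (\<integral>y. sgn y \<partial>?N i))"
      unfolding D_def using Ksub[OF g] X_int X_E
      by (subst Bochner_Integration.integral_sum) (auto intro!: sum.cong)
    also have "\<dots> = \<mu> (g mod k)"
      unfolding K_def c_def \<mu>_def using pos
      by (simp add: sum.Plus N1 N2 mod card_block sum_negf)
    finally show ?thesis .
  qed
  have T: "?T (\<phi> \<omega>) = (\<Sum>j<k. D j \<omega> * D (j + k) \<omega>)" for \<omega>
  proof -
    have "block_diff k c\<^sub>1 c\<^sub>2 m\<^sub>1 m\<^sub>2 (fst (\<phi> \<omega>)) (snd (\<phi> \<omega>)) g = D g \<omega>" if "g < 2 * k" for g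
    proof -
      have "(\<Sum>i\<in>block k m\<^sub>1 g. sgn (fst (\<phi> \<omega>) i)) = (\<Sum>i\<in>block k m\<^sub>1 g. sgn (\<omega> (Inl i)))"
        "(\<Sum>i\<in>block k m\<^sub>2 g. sgn (snd (\<phi> \<omega>) i)) = (\<Sum>i\<in>block k m\<^sub>2 g. sgn (\<omega> (Inr i)))"
        using block_subset[OF that, of m\<^sub>1] block_subset[OF that, of m\<^sub>2]
        by (auto simp: \<phi>_def subset_iff intro!: sum.cong)
      then show ?thesis
        unfolding block_diff_def D_def K_def X_def c_def
        by (simp add: sum.Plus sum_divide_distrib sum_negf)
    qed
    then show ?thesis
      unfolding split_stat_def case_prod_beta by (intro sum.cong) auto
  qed
  have E: "P.expectation (D j) = \<mu> j" "P.expectation (D (j + k)) = \<mu> j" if "j < k" for j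
    using D_E[of j] D_E[of "j + k"] that by auto
  have sets_Q: "sets Q = sets ((\<Pi>\<^sub>M i\<in>?I. borel :: real measure) \<Otimes>\<^sub>M (\<Pi>\<^sub>M i\<in>?J. borel))"
    unfolding Q_def by (intro sets_pair_measure_cong sets_PiM_cong refl N1 N2)
  have T_meas: "?T \<in> borel_measurable Q"
    using split_stat_measurable measurable_cong_sets[OF sets_Q refl] by blast
  have T_meas': "(\<lambda>\<omega>. ?T (\<phi> \<omega>)) \<in> borel_measurable ?P"
    by (rule measurable_compose[OF \<phi> T_meas])
  have T_E: "P.expectation (\<lambda>\<omega>. ?T (\<phi> \<omega>)) = S"
    unfolding T S_def using P.expectation_split_sum[OF D_ind D_sq E D_var] by (simp add: \<mu>_def)
  \<comment> \<open>The deviation event is pulled back along \<open>\<phi>\<close> to the single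
    product space, where the moments are known.\<close>
  have "measure Q {\<omega>\<in>space Q. \<bar>?T \<omega> - S\<bar> \<ge> r} = measure (distr ?P Q \<phi>) {\<omega>\<in>space Q. \<bar>?T \<omega> - S\<bar> \<ge> r}"
    using Q by simp
  also have "\<dots> = P.prob (\<phi> -` {\<omega>\<in>space Q. \<bar>?T \<omega> - S\<bar> \<ge> r} \<inter> space ?P)"
    using T_meas by (intro measure_distr[OF \<phi>]) measurable
  also have "\<phi> -` {\<omega>\<in>space Q. \<bar>?T \<omega> - S\<bar> \<ge> r} \<inter> space ?P =
      {\<omega>\<in>space ?P. \<bar>?T (\<phi> \<omega>) - P.expectation (\<lambda>\<omega>. ?T (\<phi> \<omega>))\<bar> \<ge> r}"
    using measurable_space[OF \<phi>] T_E by auto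
  also have "P.prob \<dots> \<le> P.variance (\<lambda>\<omega>. ?T (\<phi> \<omega>)) / r\<^sup>2"
    using P.integrable_split_sum_sq[OF D_ind D_sq E D_var] pos
    by (intro P.Chebyshev_inequality T_meas') (auto simp: T)
  also have "\<dots> \<le> (2 * v * S + k * v\<^sup>2) / r\<^sup>2"
    using P.variance_split_sum[OF D_ind D_sq E D_var]
    by (intro divide_right_mono) (simp_all add: T S_def \<mu>_def)
  finally show ?thesis .
qed

section \<open>The protocol: validity, privacy and correctness\<close>

definition hartley_protocol :: "nat \<Rightarrow> real \<Rightarrow> real \<Rightarrow> real \<Rightarrow> nat \<Rightarrow> nat \<Rightarrow> real protocol" where
  "hartley_protocol k \<tau> c\<^sub>1 c\<^sub>2 m\<^sub>1 m\<^sub>2 =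
     \<lparr> pub_len = 0, users1 = 2 * k * m\<^sub>1, users2 = 2 * k * m\<^sub>2,
       msg1 = \<lambda>_. borel, msg2 = \<lambda>_. borel,
       rand1 = \<lambda>i u. hartley_message k c\<^sub>1 i, rand2 = \<lambda>i u. hartley_message k c\<^sub>2 i,
       analyzer = \<lambda>(u, \<omega>). return (count_space UNIV) (split_stat k c\<^sub>1 c\<^sub>2 m\<^sub>1 m\<^sub>2 \<omega> \<le> \<tau>) \<rparr>"

lemma hartley_protocol_simps [simp]:
  "users1 (hartley_protocol k \<tau> c\<^sub>1 c\<^sub>2 m\<^sub>1 m\<^sub>2) = 2 * k * m\<^sub>1"
  "users2 (hartley_protocol k \<tau> c\<^sub>1 c\<^sub>2 m\<^sub>1 m\<^sub>2) = 2 * k * m\<^sub>2"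
  "pub_strings (hartley_protocol k \<tau> c\<^sub>1 c\<^sub>2 m\<^sub>1 m\<^sub>2) = {[]}"
  "private_coin (hartley_protocol k \<tau> c\<^sub>1 c\<^sub>2 m\<^sub>1 m\<^sub>2)"
  by (auto simp: hartley_protocol_def pub_strings_def private_coin_def)

lemma valid_hartley_protocol: "valid_protocol k (hartley_protocol k \<tau> c\<^sub>1 c\<^sub>2 m\<^sub>1 m\<^sub>2)"
proof -
  have "(\<lambda>(u, \<omega>). return (count_space UNIV) (split_stat k c\<^sub>1 c\<^sub>2 m\<^sub>1 m\<^sub>2 \<omega> \<le> \<tau>)) \<in>
    count_space {[]} \<Otimes>\<^sub>M ((\<Pi>\<^sub>M i\<in>{..<2 * k * m\<^sub>1}. borel) \<Otimes>\<^sub>M (\<Pi>\<^sub>M i\<in>{..<2 * k * m\<^sub>2}. borel))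
      \<rightarrow>\<^sub>M prob_algebra (count_space UNIV)"
    unfolding case_prod_beta
    using measurable_compose[OF measurable_snd split_stat_measurable]
    by (intro measurable_compose[OF _ measurable_return_prob_space]) measurable
  then show ?thesis
    unfolding valid_protocol_def using hartley_message_measurable
    by (simp add: hartley_protocol_def pub_strings_def)
qed

text \<open>Entries of size at most 2 scaled by \<epsilon>/6 give the bias bound \<epsilon>/3
  demanded by \<open>random_sign_ldp\<close>.\<close>

lemma ldp_hartley_message:
  assumes "0 \<le> \<epsilon>" "\<epsilon> \<le> 1"
  shows "ldp_randomizer k Us borel \<epsilon> 0 (\<lambda>u. hartley_message k (\<epsilon> / 6) i)"
proof -
  have "\<bar>\<epsilon> / 6 * hartley k i x\<bar> \<le> \<epsilon> / 3" for x
    using mult_left_mono[OF abs_hartley_le[of k i x], of "\<epsilon> / 6"] assms by (simp add: abs_mult)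
  then show ?thesis
    unfolding ldp_randomizer_def hartley_message_def using random_sign_ldp assms by auto
qed

text \<open>The only public string is \<open>[]\<close> and the analyzer is deterministic, so the
  output law is the law of the threshold test under \<open>Q\<close>. Correctness thereby reduces to
  probabilities of events about the statistic.\<close>

lemma output_law_hartley_protocol:
  fixes m\<^sub>1 m\<^sub>2 :: nat and Q :: "((nat \<Rightarrow> real) \<times> (nat \<Rightarrow> real)) measure"
  assumes p: "distribution_over k p" and q: "distribution_over k q"
    and c: "0 \<le> c\<^sub>1" "2 * c\<^sub>1 \<le> 1" "0 \<le> c\<^sub>2" "2 * c\<^sub>2 \<le> 1"
  defines "Q \<equiv> (\<Pi>\<^sub>M i\<in>{..<2 * k * m\<^sub>1}. p \<bind> hartley_message k c\<^sub>1 i) \<Otimes>\<^sub>M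
    (\<Pi>\<^sub>M i\<in>{..<2 * k * m\<^sub>2}. q \<bind> hartley_message k c\<^sub>2 i)"
  shows "prob_space Q"
    and "\<And>P. Measurable.pred borel P \<Longrightarrow>
      {\<omega> \<in> space Q. P (split_stat k c\<^sub>1 c\<^sub>2 m\<^sub>1 m\<^sub>2 \<omega>)} \<in> sets Q"
    and "measure (output_law (hartley_protocol k \<tau> c\<^sub>1 c\<^sub>2 m\<^sub>1 m\<^sub>2) p q) {b} =
      measure Q {\<omega> \<in> space Q. (split_stat k c\<^sub>1 c\<^sub>2 m\<^sub>1 m\<^sub>2 \<omega> \<le> \<tau>) = b}"
proof -
  let ?T = "split_stat k c\<^sub>1 c\<^sub>2 m\<^sub>1 m\<^sub>2"
  show prob: "prob_space Q"
    unfolding Q_def by (intro prob_space_pair prob_space_PiM prob_space_hartley_message p q c)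
  have sets: "sets Q = sets ((\<Pi>\<^sub>M i\<in>{..<2 * k * m\<^sub>1}. borel :: real measure) \<Otimes>\<^sub>M (\<Pi>\<^sub>M i\<in>{..<2 * k * m\<^sub>2}. borel))"
    unfolding Q_def
    by (intro sets_pair_measure_cong sets_PiM_cong refl sets_hartley_message p q c)
  have T [measurable]: "?T \<in> borel_measurable Q"
    using split_stat_measurable measurable_cong_sets[OF sets refl] by blast
  show "{\<omega> \<in> space Q. P (?T \<omega>)} \<in> sets Q" if [measurable]: "Measurable.pred borel P" for P
    by measurable
  let ?D = "distr Q (count_space UNIV) (\<lambda>\<omega>. ?T \<omega> \<le> \<tau>)"
  have pred: "(\<lambda>\<omega>. ?T \<omega> \<le> \<tau>) \<in> Q \<rightarrow>\<^sub>M count_space UNIV"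
    by measurable
  interpret prob_space Q by (rule prob)
  have "output_law (hartley_protocol k \<tau> c\<^sub>1 c\<^sub>2 m\<^sub>1 m\<^sub>2) p q = uniform_count_measure {[] :: bool list} \<bind>
      (\<lambda>_. Q \<bind> (return (count_space UNIV) \<circ> (\<lambda>\<omega>. ?T \<omega> \<le> \<tau>)))"
    unfolding output_law_def
    by (intro bind_cong) (auto simp: messages_law_def hartley_protocol_def Q_def comp_def pub_strings_def)
  also have "\<dots> = uniform_count_measure {[] :: bool list} \<bind> (\<lambda>_. ?D)"
    using not_empty pred by (subst bind_return_distr) auto
  also have "\<dots> = ?D"
    by (intro bind_const' prob_space_uniform_count_measure prob_space_imp_subprob_space
        prob_space_distr pred) auto
  finally show "measure (output_law (hartley_protocol k \<tau> c\<^sub>1 c\<^sub>2 m\<^sub>1 m\<^sub>2) p q) {b} =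
      measure Q {\<omega> \<in> space Q. (?T \<omega> \<le> \<tau>) = b}"
    using pred by (simp add: measure_distr vimage_def Int_def conj_commute)
qed

text \<open>The threshold \<open>2 * \<alpha>\<^sup>2\<close> lies halfway between the value 0 of
  \<open>S\<close> for equal distributions and its lower bound \<open>4 * \<alpha>\<^sup>2\<close>
  for distant ones; each error forces a deviation handled by Chebyshev.\<close>

lemma closeness_tester_hartley_protocol:
  assumes k: "k \<ge> 1" and \<alpha>: "\<alpha> > 0" and c: "0 < c\<^sub>1" "2 * c\<^sub>1 \<le> 1" "0 < c\<^sub>2" "2 * c\<^sub>2 \<le> 1"
    and m: "m\<^sub>1 > 0" "m\<^sub>2 > 0"
    and v: "1 / (m\<^sub>1 * c\<^sub>1\<^sup>2) + 1 / (m\<^sub>2 * c\<^sub>2\<^sup>2) \<le> \<alpha>\<^sup>2 / (10 * sqrt k)"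
  shows "closeness_tester k \<alpha> (hartley_protocol k (2 * \<alpha>\<^sup>2) c\<^sub>1 c\<^sub>2 m\<^sub>1 m\<^sub>2)"
  unfolding closeness_tester_def
proof (intro allI impI conjI)
  fix p q assume p: "distribution_over k p" and q: "distribution_over k q"
  let ?T = "split_stat k c\<^sub>1 c\<^sub>2 m\<^sub>1 m\<^sub>2"
  define \<tau> where "\<tau> = 2 * \<alpha>\<^sup>2"
  let ?P = "hartley_protocol k (2 * \<alpha>\<^sup>2) c\<^sub>1 c\<^sub>2 m\<^sub>1 m\<^sub>2"
  define Q where "Q = (\<Pi>\<^sub>M i\<in>{..<2 * k * m\<^sub>1}. p \<bind> hartley_message k c\<^sub>1 i) \<Otimes>\<^sub>M
    (\<Pi>\<^sub>M i\<in>{..<2 * k * m\<^sub>2}. q \<bind> hartley_message k c\<^sub>2 i)"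
  define a where "a = (\<lambda>j. \<Sum>x\<in>{1..k}. hartley k j x * measure p {x})"
  define b where "b = (\<lambda>j. \<Sum>x\<in>{1..k}. hartley k j x * measure q {x})"
  define S where "S = (\<Sum>j<k. (a j - b j)\<^sup>2)"
  define V where "V = 1 / (m\<^sub>1 * c\<^sub>1\<^sup>2) + 1 / (m\<^sub>2 * c\<^sub>2\<^sup>2)"
  have c': "0 \<le> c\<^sub>1" "2 * c\<^sub>1 \<le> 1" "0 \<le> c\<^sub>2" "2 * c\<^sub>2 \<le> 1" using c by auto
  note out = output_law_hartley_protocol[OF p q c', where m\<^sub>1=m\<^sub>1 and m\<^sub>2=m\<^sub>2, folded Q_def]
  interpret Q: prob_space Q by (rule out(1))
  have V0: "0 \<le> V" unfolding V_def by simp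
  \<comment> \<open>The factor \<open>sqrt k\<close> in the assumption on the variance serves this
    term, the accumulated noise of \<open>k\<close> coordinates.\<close>
  have kV2: "k * V\<^sup>2 \<le> \<alpha> ^ 4 / 100"
  proof -
    have "V\<^sup>2 \<le> (\<alpha>\<^sup>2 / (10 * sqrt k))\<^sup>2"
      using v V0 unfolding V_def by (intro power_mono) auto
    also have "\<dots> = \<alpha> ^ 4 / (100 * k)"
      by (simp add: power_divide power_mult_distrib flip: power_mult)
    finally show ?thesis using k by (simp add: field_simps)
  qed
  have V1: "V \<le> \<alpha>\<^sup>2 / 10"
  proof -
    have "\<alpha>\<^sup>2 / (10 * sqrt k) \<le> \<alpha>\<^sup>2 / 10"
      using k by (intro divide_left_mono) auto
    then show ?thesis using v unfolding V_def by linarith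
  qed
  have conc: "Q.prob {\<omega>\<in>space Q. \<bar>?T \<omega> - S\<bar> \<ge> r} \<le> (2 * V * S + k * V\<^sup>2) / r\<^sup>2" if "r > 0" for r
  proof -
    have "(\<Sum>x\<in>{1..k}. hartley k i x * f x) = (\<Sum>x\<in>{1..k}. hartley k (i mod k) x * f x)" for i f
      by (simp add: hartley_mod)
    then show ?thesis
      unfolding Q_def S_def V_def using k m c that
      by (intro split_stat_concentration prob_space_hartley_message[OF p] sets_hartley_message[OF p]
          prob_space_hartley_message[OF q] sets_hartley_message[OF q])
        (auto simp: integral_hartley_message p q a_def b_def)
  qed
  have neg: "Q.prob {\<omega>\<in>space Q. (?T \<omega> \<le> \<tau>) = B} = 1 - Q.prob {\<omega>\<in>space Q. (?T \<omega> \<le> \<tau>) = (\<not> B)}" for B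
    using Q.prob_neg[of "\<lambda>\<omega>. (?T \<omega> \<le> \<tau>) = (\<not> B)"] out(2)[of "\<lambda>t. (t \<le> \<tau>) = (\<not> B)"]
    by (auto intro!: arg_cong[where f=Q.prob])
  show "measure (output_law ?P p q) {True} \<ge> 2 / 3" if "p = q"
  proof -
    have S: "S = 0" using that by (simp add: S_def a_def b_def)
    \<comment> \<open>Here \<open>S = 0\<close>, so rejecting means a deviation above the threshold;
      the resulting error bound is 1/400.\<close>
    have "Q.prob {\<omega>\<in>space Q. (?T \<omega> \<le> \<tau>) = False} \<le> Q.prob {\<omega>\<in>space Q. \<bar>?T \<omega> - S\<bar> \<ge> \<tau>}"
      using out(2)[of "\<lambda>t. \<bar>t - S\<bar> \<ge> \<tau>"] S by (intro Q.finite_measure_mono) auto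
    also have "\<dots> \<le> (2 * V * S + k * V\<^sup>2) / \<tau>\<^sup>2"
      using \<alpha> by (intro conc) (simp add: \<tau>_def)
    also have "\<dots> \<le> (\<alpha> ^ 4 / 100) / \<tau>\<^sup>2"
      using kV2 S by (intro divide_right_mono) auto
    also have "\<dots> \<le> 1 / 3"
      using \<alpha> by (simp add: \<tau>_def power_mult_distrib flip: power_mult)
    finally show ?thesis
      using neg[of True] unfolding out(3)[where \<tau>="2 * \<alpha>\<^sup>2"] \<tau>_def by simp
  qed
  show "measure (output_law ?P p q) {False} \<ge> 2 / 3" if tv: "tv_dist k p q > \<alpha>"
  proof -
    have "4 * \<alpha>\<^sup>2 \<le> (2 * tv_dist k p q)\<^sup>2"
      using tv \<alpha> power_mono[of \<alpha> "tv_dist k p q" 2] by (simp add: power_mult_distrib)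
    also have "\<dots> \<le> S"
      unfolding S_def a_def b_def by (rule tv_dist_le_hartley)
    finally have S: "4 * \<alpha>\<^sup>2 \<le> S" .
    then have S0: "S > 0" using \<alpha> by (smt (verit) zero_less_power)
    \<comment> \<open>The threshold is at most \<open>S / 2\<close>. The deviation is measured
      relative to \<open>S\<close> because the variance bound itself grows with
      \<open>S\<close>.\<close>
    have "S / 2 \<le> \<bar>t - S\<bar>" if "t \<le> \<tau>" for t
      using S that unfolding \<tau>_def by linarith
    then have "Q.prob {\<omega>\<in>space Q. (?T \<omega> \<le> \<tau>) = True} \<le> Q.prob {\<omega>\<in>space Q. \<bar>?T \<omega> - S\<bar> \<ge> S / 2}"
      using out(2)[of "\<lambda>t. \<bar>t - S\<bar> \<ge> S / 2"] by (intro Q.finite_measure_mono) auto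
    also have "\<dots> \<le> (2 * V * S + k * V\<^sup>2) / (S / 2)\<^sup>2"
      using S0 by (intro conc) simp
    \<comment> \<open>Insert \<open>\<alpha>\<^sup>2 \<le> S / 4\<close> into the two bounds on
      \<open>V\<close>. The quotient is then 1/5 + 1/400.\<close>
    also have "\<dots> \<le> (2 * (S / 40) * S + S\<^sup>2 / 1600) / (S / 2)\<^sup>2"
    proof (intro divide_right_mono add_mono mult_right_mono mult_left_mono)
      show "V \<le> S / 40" using V1 S by simp
      have "(4 * \<alpha>\<^sup>2)\<^sup>2 \<le> S\<^sup>2" using S by (intro power_mono) auto
      then show "k * V\<^sup>2 \<le> S\<^sup>2 / 1600" using kV2 by (simp add: power_mult_distrib flip: power_mult)
    qed (use S0 in auto)
    also have "\<dots> \<le> 1 / 3"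
      using S0 by (simp add: field_simps power2_eq_square)
    finally show ?thesis
      using neg[of False] unfolding out(3)[where \<tau>="2 * \<alpha>\<^sup>2"] \<tau>_def by simp
  qed
qed

section \<open>Block sizes and the final count of users\<close>

lemma block_size_bounds:
  fixes k :: nat and \<alpha> \<epsilon> :: real
  assumes k: "k \<ge> 1" and \<alpha>: "\<alpha> \<in> {0<..1}" and \<epsilon>: "\<epsilon> \<in> {0<..1}"
  defines "m \<equiv> nat \<lceil>720 * sqrt k / (\<alpha>\<^sup>2 * \<epsilon>\<^sup>2)\<rceil>"
  shows "m > 0" and "1 / (m * (\<epsilon> / 6)\<^sup>2) \<le> \<alpha>\<^sup>2 / (20 * sqrt k)"
    and "real (2 * k * m) \<le> 1442 * (real k powr (3 / 2) / (\<alpha>\<^sup>2 * \<epsilon>\<^sup>2))"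
proof -
  define x where "x = sqrt k / (\<alpha>\<^sup>2 * \<epsilon>\<^sup>2)"
  have pos: "\<alpha>\<^sup>2 > 0" "\<epsilon>\<^sup>2 > 0" "sqrt k > 0" using assms by auto
  have "\<alpha>\<^sup>2 * \<epsilon>\<^sup>2 \<le> 1 * 1"
    using \<alpha> \<epsilon> by (intro mult_mono power_le_one) auto
  \<comment> \<open>With \<open>x\<close> at least 1, rounding up to an integer costs at most one
    more multiple of \<open>x\<close>.\<close>
  then have x1: "1 \<le> x"
    using k pos unfolding x_def by (subst le_divide_eq_1_pos) (auto intro: order_trans[of _ 1])
  have m: "720 * x \<le> m" "m \<le> 720 * x + 1"
    using x1 unfolding m_def x_def by (auto simp: of_nat_ceiling)
  show m0: "m > 0" using m(1) x1 by (cases "m = 0") auto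
  \<comment> \<open>The constant is 36 * 20: 36 undoes the square of \<epsilon>/6, and 20 leaves
    each group half of the variance budget.\<close>
  have "720 * sqrt k \<le> m * (\<alpha>\<^sup>2 * \<epsilon>\<^sup>2)"
    using m(1) pos unfolding x_def by (simp add: field_simps)
  then show "1 / (m * (\<epsilon> / 6)\<^sup>2) \<le> \<alpha>\<^sup>2 / (20 * sqrt k)"
    using pos m0 by (simp add: field_simps power_divide)
  have "real k powr (3 / 2) = real k powr (1 + 1 / 2)" by simp
  also have "\<dots> = k * sqrt k" using k by (subst powr_add) (simp add: powr_half_sqrt)
  finally have K: "real k powr (3 / 2) / (\<alpha>\<^sup>2 * \<epsilon>\<^sup>2) = k * x" by (simp add: x_def)
  \<comment> \<open>Two halves of \<open>k\<close> blocks with at most \<open>721 * x\<close> users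
    each give the constant 1442.\<close>
  have "real m \<le> 721 * x" using m x1 by linarith
  then show "real (2 * k * m) \<le> 1442 * (real k powr (3 / 2) / (\<alpha>\<^sup>2 * \<epsilon>\<^sup>2))"
    unfolding K using mult_left_mono[of "real m" "721 * x" "2 * real k"] by simp
qed

theorem theorem3p4:
  "\<exists>C::real. C > 0 \<and>
     (\<forall>k::nat. \<forall>\<alpha> \<epsilon>\<^sub>1 \<epsilon>\<^sub>2 :: real.
        k \<ge> 1 \<longrightarrow> \<alpha> \<in> {0<..1} \<longrightarrow> \<epsilon>\<^sub>1 \<in> {0<..1} \<longrightarrow> \<epsilon>\<^sub>2 \<in> {0<..1} \<longrightarrow>
        (\<exists>P :: real protocol.
           valid_protocol k P \<and>
           private_coin P \<and>
           closeness_tester k \<alpha> P \<and>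
           real (users1 P) \<le> C * (real k powr (3 / 2) / (\<alpha>\<^sup>2 * \<epsilon>\<^sub>1\<^sup>2)) \<and>
           real (users2 P) \<le> C * (real k powr (3 / 2) / (\<alpha>\<^sup>2 * \<epsilon>\<^sub>2\<^sup>2)) \<and>
           ldp_group1 k \<epsilon>\<^sub>1 0 P \<and>
           ldp_group2 k \<epsilon>\<^sub>2 0 P))"
proof (intro exI[of _ 1442] conjI allI impI)
  fix k :: nat and \<alpha> \<epsilon>\<^sub>1 \<epsilon>\<^sub>2 :: real
  assume k: "k \<ge> 1" and \<alpha>: "\<alpha> \<in> {0<..1}" and \<epsilon>: "\<epsilon>\<^sub>1 \<in> {0<..1}" "\<epsilon>\<^sub>2 \<in> {0<..1}"
  define m\<^sub>1 where "m\<^sub>1 = nat \<lceil>720 * sqrt k / (\<alpha>\<^sup>2 * \<epsilon>\<^sub>1\<^sup>2)\<rceil>"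
  define m\<^sub>2 where "m\<^sub>2 = nat \<lceil>720 * sqrt k / (\<alpha>\<^sup>2 * \<epsilon>\<^sub>2\<^sup>2)\<rceil>"
  note b1 = block_size_bounds[OF k \<alpha> \<epsilon>(1), folded m\<^sub>1_def]
  note b2 = block_size_bounds[OF k \<alpha> \<epsilon>(2), folded m\<^sub>2_def]
  let ?P = "hartley_protocol k (2 * \<alpha>\<^sup>2) (\<epsilon>\<^sub>1 / 6) (\<epsilon>\<^sub>2 / 6) m\<^sub>1 m\<^sub>2"
  show "\<exists>P :: real protocol.
           valid_protocol k P \<and>
           private_coin P \<and>
           closeness_tester k \<alpha> P \<and>
           real (users1 P) \<le> 1442 * (real k powr (3 / 2) / (\<alpha>\<^sup>2 * \<epsilon>\<^sub>1\<^sup>2)) \<and>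
           real (users2 P) \<le> 1442 * (real k powr (3 / 2) / (\<alpha>\<^sup>2 * \<epsilon>\<^sub>2\<^sup>2)) \<and>
           ldp_group1 k \<epsilon>\<^sub>1 0 P \<and>
           ldp_group2 k \<epsilon>\<^sub>2 0 P"
  proof (intro exI[of _ ?P] conjI)
    show "closeness_tester k \<alpha> ?P"
    proof (rule closeness_tester_hartley_protocol)
      \<comment> \<open>The two groups contribute one half of the budget each, whatever the ratio of
        their privacy parameters.\<close>
      show "1 / (m\<^sub>1 * (\<epsilon>\<^sub>1 / 6)\<^sup>2) + 1 / (m\<^sub>2 * (\<epsilon>\<^sub>2 / 6)\<^sup>2) \<le> \<alpha>\<^sup>2 / (10 * sqrt k)"
        using add_mono[OF b1(2) b2(2)] by simp
    qed (use k \<alpha> \<epsilon> b1(1) b2(1) in auto)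
    show "ldp_group1 k \<epsilon>\<^sub>1 0 ?P" "ldp_group2 k \<epsilon>\<^sub>2 0 ?P"
      using \<epsilon> ldp_hartley_message
      by (auto simp: ldp_group1_def ldp_group2_def hartley_protocol_def)
  qed (use b1(3) b2(3) valid_hartley_protocol in auto)
qed simp

end
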